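(* Let $G$ be a finite connected directed acyclic graph that has more than one sink or more than one source. Then the chromatic quasisymmetric function $X_G(x;q)$ is not symmetric.
   Context: Directed graphs here are finite and simple (at most one edge between two vertices), and connected means that the underlying undirected graph is connected. For a directed acyclic graph $G$ with vertex set $V$, a proper coloring is a map $\kappa:V\to\{1,2,3,\ldots\}$ taking distinct values on adjacent vertices; $\mathrm{asc}(\kappa)$ is the number of directed edges $(u,v)$ (from $u$ to $v$) with $\kappa(u)<\kappa(v)$. The chromatic quasisymmetric function is $X_G(x;q)=\sum_\kappa q^{\mathrm{asc}(\kappa)}\prod_{v\in V}x_{\kappa(v)}$, summed over all proper colorings, a power series in $x_1,x_2,\ldots$ with coefficients in $\mathbb{Z}[q]$; it is symmetric if it is invariant under all permutations of the variables $x_i$. (For a graph with vertices labeled $1,\ldots,n$, edges are directed from the smaller label to the larger.) A source is a vertex with no incoming edges; a sink is a vertex with no outgoing edges. *)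

theory Defs
  imports
    "Graph_Theory.Graph_Theory"
    "HOL-Library.FuncSet"
    "HOL-Library.Poly_Mapping"
    "HOL-Combinatorics.Permutations"
    "HOL-Computational_Algebra.Polynomial"
begin

text \<open>
  The locale \<open>digraph\<close> covers finite digraphs without loops and without parallel arcs; pairs of
  antiparallel arcs are excluded once \<open>acyclic (arcs_ends G)\<close> is assumed.  The predicate
  \<open>connected G\<close> is connectedness of the symmetric closure, i.e. of the underlying undirected graph.
\<close>

definition sources :: "('a, 'b) pre_digraph \<Rightarrow> 'a set" where
  "sources G = {v \<in> verts G. in_arcs G v = {}}"

definition sinks :: "('a, 'b) pre_digraph \<Rightarrow> 'a set" where
  "sinks G = {v \<in> verts G. out_arcs G v = {}}"

text \<open>
  A formal power series in \<open>x\<^sub>1, x\<^sub>2, \<dots>\<close> is given by the coefficients of its monomials, a monomial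
  being a finitely supported exponent vector.  Variables are indexed by \<open>nat\<close>, but \<open>x\<^sub>0\<close> never
  occurs in the series below and is never moved by a permutation of the variables.
\<close>

type_synonym 'c power_series = "(nat \<Rightarrow>\<^sub>0 nat) \<Rightarrow> 'c"

text \<open>
  For bijective \<open>\<pi>\<close>, replacing each \<open>x\<^sub>i\<close> by \<open>x\<^bsub>\<pi> i\<^esub>\<close> turns the monomial with exponent vector \<open>m \<circ> \<pi>\<close> into the one
  with exponent vector \<open>m\<close>.
\<close>

definition permute_vars :: "(nat \<Rightarrow> nat) \<Rightarrow> 'c power_series \<Rightarrow> 'c power_series" where
  "permute_vars \<pi> F = (\<lambda>m. F (Poly_Mapping.map_key \<pi> m))"

definition symmetric_series :: "'c power_series \<Rightarrow> bool" where
  "symmetric_series F \<longleftrightarrow> (\<forall>\<pi>. \<pi> permutes {1..} \<longrightarrow> permute_vars \<pi> F = F)"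

text \<open>Colorings are extensional, so that each map on the vertex set is counted exactly once.\<close>

definition proper_colorings :: "('a, 'b) pre_digraph \<Rightarrow> ('a \<Rightarrow> nat) set" where
  "proper_colorings G =
     {\<kappa> \<in> verts G \<rightarrow>\<^sub>E {1..}. \<forall>e \<in> arcs G. \<kappa> (tail G e) \<noteq> \<kappa> (head G e)}"

definition asc :: "('a, 'b) pre_digraph \<Rightarrow> ('a \<Rightarrow> nat) \<Rightarrow> nat" where
  "asc G \<kappa> = card {e \<in> arcs G. \<kappa> (tail G e) < \<kappa> (head G e)}"

text \<open>The exponent vector of the product of the \<open>x\<^bsub>\<kappa> v\<^esub>\<close> over all vertices \<open>v\<close>.\<close>

definition coloring_monomial :: "('a, 'b) pre_digraph \<Rightarrow> ('a \<Rightarrow> nat) \<Rightarrow> (nat \<Rightarrow>\<^sub>0 nat)" where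
  "coloring_monomial G \<kappa> = (\<Sum>v\<in>verts G. Poly_Mapping.single (\<kappa> v) 1)"

lemma lookup_coloring_monomial:
  assumes "finite (verts G)"
  shows "Poly_Mapping.lookup (coloring_monomial G \<kappa>) i = card {v \<in> verts G. \<kappa> v = i}"
proof -
  have "Poly_Mapping.lookup (coloring_monomial G \<kappa>) i
      = (\<Sum>v\<in>verts G. if \<kappa> v = i then 1 else 0)"
    by (simp add: coloring_monomial_def lookup_sum lookup_single when_def cong: if_cong)
  also have "\<dots> = card {v \<in> verts G. \<kappa> v = i}"
    using assms by (simp add: sum.If_cases Int_def)
  finally show ?thesis .
qed

text \<open>
  The coefficient of each monomial is a polynomial in \<open>q\<close>, where \<open>monom 1 k\<close> is \<open>q\<close> to the power
  \<open>k\<close>.  By \<open>finite_colorings_of_monomial\<close> below the sum is finite for finite \<open>G\<close>.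
\<close>

definition chromatic_quasisymmetric :: "('a, 'b) pre_digraph \<Rightarrow> int poly power_series" where
  "chromatic_quasisymmetric G =
     (\<lambda>m. \<Sum>\<kappa> | \<kappa> \<in> proper_colorings G \<and> coloring_monomial G \<kappa> = m. monom 1 (asc G \<kappa>))"

lemma finite_colorings_of_monomial:
  assumes "finite (verts G)"
  shows "finite {\<kappa> \<in> proper_colorings G. coloring_monomial G \<kappa> = m}"
proof (rule finite_subset)
  show "{\<kappa> \<in> proper_colorings G. coloring_monomial G \<kappa> = m}
      \<subseteq> verts G \<rightarrow>\<^sub>E Poly_Mapping.keys m"
  proof
    fix \<kappa> assume \<kappa>: "\<kappa> \<in> {\<kappa> \<in> proper_colorings G. coloring_monomial G \<kappa> = m}"
    have "\<kappa> v \<in> Poly_Mapping.keys m" if "v \<in> verts G" for v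
    proof -
      have "Poly_Mapping.lookup m (\<kappa> v) = card {w \<in> verts G. \<kappa> w = \<kappa> v}"
        using \<kappa> lookup_coloring_monomial[OF assms] by blast
      moreover have "card {w \<in> verts G. \<kappa> w = \<kappa> v} \<noteq> 0"
        using assms that by auto
      ultimately show ?thesis by (simp add: in_keys_iff)
    qed
    then show "\<kappa> \<in> verts G \<rightarrow>\<^sub>E Poly_Mapping.keys m"
      using \<kappa> by (auto simp: proper_colorings_def PiE_def)
  qed
  show "finite (verts G \<rightarrow>\<^sub>E Poly_Mapping.keys m)"
    using assms by (simp add: finite_PiE)
qed

end

theory Submission
  imports Defs
begin

text \<open>
  The proof looks only at the coefficient of the highest power of \<open>q\<close>, the number of edges.  It
  counts the colorings that increase strictly along every edge, and if the whole series is
  symmetric then so is this coefficient.  Let \<open>f\<close> be this symmetric function, let \<open>n\<close> be the number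
  of vertices, and pair \<open>f\<close> with the product of a power sum \<open>p\<^sub>M\<close> and \<open>n - M\<close> factors \<open>h\<^sub>1\<close>,
  expanding \<open>p\<^sub>M\<close> as an alternating sum of products of complete homogeneous functions.

  On the combinatorial side, \<open>p\<^sub>M\<close> picks out vertex sets of size \<open>M\<close> with a unique source, each
  counted with the same sign (\<open>power_sum_functional_strict_count\<close>), while the factors \<open>h\<^sub>1\<close>
  remove the other vertices one at a time.  If \<open>p\<^sub>M\<close> is used on the last colors, the chosen set is
  closed under outgoing edges (\<open>power_sum_functional_after_singletons_pos\<close>); if it is used
  on the first colors, the chosen set is closed under incoming edges
  (\<open>power_sum_functional_before_singletons_nonzero\<close>).  By symmetry both orders give the same value.

  Now let \<open>M\<close> be the largest number of vertices reachable from one vertex.  A reachable set of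
  size \<open>M\<close> makes the first count nonzero.  So the second count is nonzero as well, and there is a
  set \<open>D\<close> of size \<open>M\<close> that is closed under incoming edges and has a unique source \<open>b\<close>.  All of
  \<open>D\<close> is reachable from \<open>b\<close>, and by maximality of \<open>M\<close> it is everything that is reachable from \<open>b\<close>.
  Hence \<open>D\<close> is closed under edges in both directions, and by connectedness it is the whole vertex
  set.  So the graph has exactly one source (\<open>symmetric_counts_unique_minimal\<close>).  Reversing
  all edges reverses the order of the colors and so preserves the symmetry of \<open>f\<close>; thus there is
  exactly one sink, too.
\<close>

section \<open>Counting strict colorings by peeling off color classes\<close>

text \<open>
  Minimality refers to edges inside \<open>Q\<close> only, so these are the sources of the subgraph induced on
  \<open>Q\<close>.
\<close>

definition minimal_in :: "('a \<times> 'a) set \<Rightarrow> 'a set \<Rightarrow> 'a set" where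
  "minimal_in R Q = {v \<in> Q. \<forall>u\<in>Q. (u, v) \<notin> R}"

text \<open>
  In a coloring that increases along edges, the vertices of the smallest color form a set of
  minimal elements, and any set of minimal elements can play this part.  So this recursion counts
  the increasing colorings in which the \<open>i\<close>-th color is used \<open>\<beta> ! i\<close> times; see
  \<open>card_strict_colorings\<close>.
\<close>

fun strict_count :: "('a \<times> 'a) set \<Rightarrow> 'a set \<Rightarrow> nat list \<Rightarrow> int" where
  "strict_count R Q [] = (if Q = {} then 1 else 0)"
| "strict_count R Q (b # \<beta>) =
     (\<Sum>A | A \<subseteq> minimal_in R Q \<and> card A = b. strict_count R (Q - A) \<beta>)"

lemma minimal_in_subset: "minimal_in R Q \<subseteq> Q"
  by (auto simp: minimal_in_def)

lemma finite_minimal_in: "finite Q \<Longrightarrow> finite (minimal_in R Q)"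
  by (rule finite_subset[OF minimal_in_subset])

lemma minimal_in_nonempty:
  assumes "finite R" "acyclic R" "Q \<noteq> {}"
  shows "minimal_in R Q \<noteq> {}"
proof -
  have "wf R" using assms finite_acyclic_wf by blast
  moreover obtain x where "x \<in> Q" using assms by blast
  ultimately obtain z where "z \<in> Q" "\<And>y. (y, z) \<in> R \<Longrightarrow> y \<notin> Q"
    using wfE_min by metis
  then show ?thesis by (auto simp: minimal_in_def)
qed

text \<open>
  The condition on all colors \<open>i\<close>, including those beyond the end of \<open>\<beta>\<close>, forces every vertex to
  have one of the listed colors.
\<close>

definition strict_colorings :: "('a \<times> 'a) set \<Rightarrow> 'a set \<Rightarrow> nat list \<Rightarrow> ('a \<Rightarrow> nat) set" where
  "strict_colorings R Q \<beta> =
     {\<kappa> \<in> extensional Q. (\<forall>u\<in>Q. \<forall>v\<in>Q. (u, v) \<in> R \<longrightarrow> \<kappa> u < \<kappa> v) \<and>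
        (\<forall>i. card {v \<in> Q. \<kappa> v = i} = nth_default 0 \<beta> i)}"

lemma nth_default_shift:
  "nth_default 0 (replicate k 0 @ b # \<beta>) i =
     (if i = k then b else nth_default 0 (replicate (Suc k) 0 @ \<beta>) i)"
proof (cases i k rule: linorder_cases)
  case greater
  then obtain j where "i = Suc (k + j)" using less_iff_Suc_add by blast
  then show ?thesis by (simp add: nth_default_def nth_append)
qed (simp_all add: nth_default_def nth_append del: replicate_Suc)

text \<open>
  The leading zeros shift the smallest color in use to \<open>k\<close>; removing the class of color \<open>k\<close> then
  leaves the remaining colors in place.
\<close>

lemma strict_colorings_Cons_bij:
  assumes fin: "finite Q"
  shows "bij_betw (\<lambda>\<kappa>. ({v \<in> Q. \<kappa> v = k}, restrict \<kappa> {v \<in> Q. \<kappa> v \<noteq> k}))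
     (strict_colorings R Q (replicate k 0 @ b # \<beta>))
     (SIGMA A : {A. A \<subseteq> minimal_in R Q \<and> card A = b}.
        strict_colorings R (Q - A) (replicate (Suc k) 0 @ \<beta>))"
    (is "bij_betw ?f ?K ?S")
proof (rule bij_betw_byWitness[where f' = "\<lambda>(A, \<tau>) v. if v \<in> A then k else \<tau> v"])
  have low: "k < \<tau> v"
    if "\<tau> \<in> strict_colorings R (Q - A) (replicate (Suc k) 0 @ \<beta>)" "v \<in> Q - A" for A \<tau> v
  proof (rule ccontr)
    assume "\<not> k < \<tau> v"
    then have "card {w \<in> Q - A. \<tau> w = \<tau> v} = 0"
      using that by (auto simp: strict_colorings_def nth_default_def nth_append simp del: replicate_Suc)
    then show False using fin that(2) by auto
  qed
  have low': "k \<le> \<kappa> v" if "\<kappa> \<in> ?K" "v \<in> Q" for \<kappa> v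
  proof (rule ccontr)
    assume "\<not> k \<le> \<kappa> v"
    then have "card {w \<in> Q. \<kappa> w = \<kappa> v} = 0"
      using that by (auto simp: strict_colorings_def nth_default_def nth_append)
    then show False using fin that(2) by auto
  qed
  show "\<forall>\<kappa>\<in>?K. (\<lambda>(A, \<tau>) v. if v \<in> A then k else \<tau> v) (?f \<kappa>) = \<kappa>"
    by (auto simp: strict_colorings_def fun_eq_iff restrict_def extensional_def)
  show "\<forall>p\<in>?S. ?f ((\<lambda>(A, \<tau>) v. if v \<in> A then k else \<tau> v) p) = p"
  proof
    fix p assume "p \<in> ?S"
    then obtain A \<tau> where p: "p = (A, \<tau>)" and A: "A \<subseteq> minimal_in R Q"
      and \<tau>: "\<tau> \<in> strict_colorings R (Q - A) (replicate (Suc k) 0 @ \<beta>)"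
      by auto
    have "\<tau> v \<noteq> k" if "v \<in> Q - A" for v using low[OF \<tau> that] by simp
    moreover have "A \<subseteq> Q" using A minimal_in_subset[of R Q] by auto
    moreover have "\<tau> \<in> extensional (Q - A)" using \<tau> by (simp add: strict_colorings_def)
    ultimately show "?f ((\<lambda>(A, \<tau>) v. if v \<in> A then k else \<tau> v) p) = p"
      unfolding p by (auto simp: fun_eq_iff restrict_def extensional_def)
  qed
  show "?f ` ?K \<subseteq> ?S"
  proof (rule image_subsetI)
    fix \<kappa> assume \<kappa>: "\<kappa> \<in> ?K"
    let ?A = "{v \<in> Q. \<kappa> v = k}"
    have cnt: "card {v \<in> Q. \<kappa> v = i} = nth_default 0 (replicate k 0 @ b # \<beta>) i" for i
      using \<kappa> by (simp add: strict_colorings_def)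
    have "?A \<subseteq> minimal_in R Q"
      using \<kappa> low'[OF \<kappa>] by (fastforce simp: minimal_in_def strict_colorings_def)
    moreover have "card ?A = b" using cnt[of k] by (simp add: nth_default_shift)
    moreover have "restrict \<kappa> {v \<in> Q. \<kappa> v \<noteq> k}
        \<in> strict_colorings R (Q - ?A) (replicate (Suc k) 0 @ \<beta>)"
    proof -
      have eq: "Q - ?A = {v \<in> Q. \<kappa> v \<noteq> k}" by auto
      have "card {v \<in> Q - ?A. restrict \<kappa> (Q - ?A) v = i}
          = nth_default 0 (replicate (Suc k) 0 @ \<beta>) i" for i
      proof (cases "i = k")
        case True
        then have empty: "{v \<in> Q - ?A. restrict \<kappa> (Q - ?A) v = i} = {}" by auto
        show ?thesis using True unfolding empty
          by (simp add: nth_default_def nth_append del: replicate_Suc)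
      next
        case False
        then have "{v \<in> Q - ?A. restrict \<kappa> (Q - ?A) v = i} = {v \<in> Q. \<kappa> v = i}" by auto
        then show ?thesis using cnt[of i] False by (simp add: nth_default_shift del: replicate_Suc)
      qed
      moreover have "\<forall>u\<in>Q. \<forall>v\<in>Q. (u, v) \<in> R \<longrightarrow> \<kappa> u < \<kappa> v"
        using \<kappa> by (simp add: strict_colorings_def)
      ultimately show ?thesis
        unfolding eq[symmetric] strict_colorings_def by auto
    qed
    ultimately show "?f \<kappa> \<in> ?S" by blast
  qed
  show "(\<lambda>(A, \<tau>) v. if v \<in> A then k else \<tau> v) ` ?S \<subseteq> ?K"
  proof (rule image_subsetI)
    fix p assume "p \<in> ?S"
    then obtain A \<tau> where p: "p = (A, \<tau>)" and A: "A \<subseteq> minimal_in R Q" "card A = b"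
      and \<tau>: "\<tau> \<in> strict_colorings R (Q - A) (replicate (Suc k) 0 @ \<beta>)"
      by auto
    let ?\<kappa> = "\<lambda>v. if v \<in> A then k else \<tau> v"
    have AQ: "A \<subseteq> Q" using A minimal_in_subset[of R Q] by auto
    have "card {v \<in> Q. ?\<kappa> v = i} = nth_default 0 (replicate k 0 @ b # \<beta>) i" for i
    proof (cases "i = k")
      case True
      have "\<tau> v \<noteq> k" if "v \<in> Q - A" for v using low[OF \<tau> that] by simp
      then have "{v \<in> Q. ?\<kappa> v = i} = A" using True AQ by auto
      then show ?thesis using True A by (simp add: nth_default_shift)
    next
      case False
      then have "{v \<in> Q. ?\<kappa> v = i} = {v \<in> Q - A. \<tau> v = i}" using AQ by auto
      then show ?thesis using \<tau> False
        by (simp add: nth_default_shift strict_colorings_def del: replicate_Suc)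
    qed
    moreover have "?\<kappa> u < ?\<kappa> v" if "u \<in> Q" "v \<in> Q" "(u, v) \<in> R" for u v
    proof -
      have "v \<notin> A" using A that by (auto simp: minimal_in_def)
      then show ?thesis using low[OF \<tau>, of v] \<tau> that by (auto simp: strict_colorings_def)
    qed
    moreover have "?\<kappa> \<in> extensional Q"
      using \<tau> AQ by (auto simp: strict_colorings_def extensional_def)
    ultimately show "(\<lambda>(A, \<tau>) v. if v \<in> A then k else \<tau> v) p \<in> ?K"
      unfolding p by (auto simp: strict_colorings_def)
  qed
qed

lemma card_strict_colorings:
  assumes "finite Q"
  shows "finite (strict_colorings R Q (replicate k 0 @ \<beta>)) \<and>
    int (card (strict_colorings R Q (replicate k 0 @ \<beta>))) = strict_count R Q \<beta>"
  using assms
proof (induction \<beta> arbitrary: Q k)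
  case Nil
  have "strict_colorings R Q (replicate k 0 @ []) = (if Q = {} then {\<lambda>v. undefined} else {})"
  proof -
    have "nth_default 0 (replicate k 0) i = (0::nat)" for i
      by (simp add: nth_default_def)
    then show ?thesis
      using Nil by (auto simp: strict_colorings_def)
  qed
  then show ?case by simp
next
  case (Cons b \<beta>)
  let ?I = "{A. A \<subseteq> minimal_in R Q \<and> card A = b}"
  let ?T = "\<lambda>A. strict_colorings R (Q - A) (replicate (Suc k) 0 @ \<beta>)"
  have fI: "finite ?I" using finite_minimal_in[OF Cons.prems] by simp
  have IH: "finite (?T A)" "int (card (?T A)) = strict_count R (Q - A) \<beta>" for A
    using Cons.IH[of "Q - A" "Suc k"] Cons.prems by auto
  note bij = strict_colorings_Cons_bij[OF Cons.prems, of k R b \<beta>]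
  have "finite (Sigma ?I ?T)" using fI IH(1) by (intro finite_SigmaI)
  then have "finite (strict_colorings R Q (replicate k 0 @ b # \<beta>))"
    using bij_betw_finite[OF bij] by blast
  moreover have "int (card (strict_colorings R Q (replicate k 0 @ b # \<beta>))) =
      int (\<Sum>A\<in>?I. card (?T A))"
    using bij_betw_same_card[OF bij] card_SigmaI[OF fI, of ?T] IH(1) by simp
  ultimately show ?case using IH(2) by (simp del: replicate_Suc)
qed

text \<open>
  A set of minimal and a set of maximal elements can be removed in either order: after removing
  \<open>A\<close> an element \<open>b\<close> cannot become maximal, because an edge from \<open>b\<close> into \<open>A\<close> would contradict
  the minimality of \<open>A\<close>.
\<close>

lemma minimal_converse_swap1:
  assumes "A \<subseteq> minimal_in R Q" "B \<subseteq> minimal_in (R\<inverse>) (Q - A)"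
  shows "B \<subseteq> minimal_in (R\<inverse>) Q \<and> A \<subseteq> minimal_in R (Q - B)"
proof (intro conjI subsetI)
  fix b assume "b \<in> B"
  then have b: "b \<in> Q - A" "\<forall>u\<in>Q - A. (b, u) \<notin> R" using assms(2) by (auto simp: minimal_in_def)
  then have "\<forall>u\<in>A. (b, u) \<notin> R" using assms(1) by (auto simp: minimal_in_def)
  then show "b \<in> minimal_in (R\<inverse>) Q" using b by (auto simp: minimal_in_def)
next
  fix a assume "a \<in> A"
  then show "a \<in> minimal_in R (Q - B)" using assms by (auto simp: minimal_in_def)
qed

lemma minimal_converse_swap:
  "A \<subseteq> minimal_in R Q \<and> B \<subseteq> minimal_in (R\<inverse>) (Q - A) \<longleftrightarrow>
   B \<subseteq> minimal_in (R\<inverse>) Q \<and> A \<subseteq> minimal_in R (Q - B)"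
proof (intro iffI; elim conjE)
  assume "A \<subseteq> minimal_in R Q" "B \<subseteq> minimal_in (R\<inverse>) (Q - A)"
  then show "B \<subseteq> minimal_in (R\<inverse>) Q \<and> A \<subseteq> minimal_in R (Q - B)"
    by (rule minimal_converse_swap1)
next
  assume "B \<subseteq> minimal_in (R\<inverse>) Q" "A \<subseteq> minimal_in R (Q - B)"
  then show "A \<subseteq> minimal_in R Q \<and> B \<subseteq> minimal_in (R\<inverse>) (Q - A)"
    using minimal_converse_swap1[of B "R\<inverse>" Q A] by simp
qed

text \<open>
  The recursion peels off color classes from below; since the two ends can be peeled
  independently, the largest color can be peeled off first just as well.
\<close>

lemma strict_count_snoc:
  assumes "finite Q"
  shows "strict_count R Q (\<beta> @ [b]) =
    (\<Sum>B | B \<subseteq> minimal_in (R\<inverse>) Q \<and> card B = b. strict_count R (Q - B) \<beta>)"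
  using assms
proof (induction \<beta> arbitrary: Q)
  case Nil
  have "A \<subseteq> minimal_in S Q \<and> card A = b \<and> Q - A = {} \<longleftrightarrow>
      A = Q \<and> minimal_in S Q = Q \<and> card Q = b" for A and S :: "('a \<times> 'a) set"
    using minimal_in_subset[of S Q] by (metis Diff_eq_empty_iff order.refl subset_antisym subset_trans)
  then have *: "(\<Sum>A | A \<subseteq> minimal_in S Q \<and> card A = b. if Q - A = {} then 1 else 0 :: int) =
      (if minimal_in S Q = Q \<and> card Q = b then 1 else 0)" for S :: "('a \<times> 'a) set"
    using finite_minimal_in[OF Nil, of S]
    by (subst sum.inter_filter[symmetric]) (auto simp: conj_assoc)
  have "minimal_in (R\<inverse>) Q = Q \<longleftrightarrow> minimal_in R Q = Q"
    by (auto simp: minimal_in_def)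
  then show ?case using *[of R] *[of "R\<inverse>"] by simp
next
  case (Cons c \<beta>)
  let ?m = "\<lambda>Q. minimal_in R Q" and ?M = "\<lambda>Q. minimal_in (R\<inverse>) Q"
  have fin: "finite {A. A \<subseteq> minimal_in S Q' \<and> card A = n}"
    if "Q' \<subseteq> Q" for S :: "('a \<times> 'a) set" and Q' n
    using finite_minimal_in[of Q' S] finite_subset[OF that Cons.prems] by simp
  have "strict_count R Q ((c # \<beta>) @ [b]) =
      (\<Sum>A | A \<subseteq> ?m Q \<and> card A = c. \<Sum>B | B \<subseteq> ?M (Q - A) \<and> card B = b.
         strict_count R (Q - A - B) \<beta>)"
    using Cons by simp
  also have "\<dots> = (\<Sum>(A, B) \<in> (SIGMA A : {A. A \<subseteq> ?m Q \<and> card A = c}.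
        {B. B \<subseteq> ?M (Q - A) \<and> card B = b}). strict_count R (Q - A - B) \<beta>)"
    by (rule sum.Sigma) (auto intro!: fin)
  also have "\<dots> = (\<Sum>(B, A) \<in> (SIGMA B : {B. B \<subseteq> ?M Q \<and> card B = b}.
        {A. A \<subseteq> ?m (Q - B) \<and> card A = c}). strict_count R (Q - B - A) \<beta>)"
  proof (rule sum.reindex_bij_witness[where i = prod.swap and j = prod.swap], goal_cases)
    case (2 p) then show ?case using minimal_converse_swap[of "fst p" R Q "snd p"] by auto
  next
    case (4 p) then show ?case using minimal_converse_swap[of "snd p" R Q "fst p"] by auto
  next
    case (5 p)
    have "Q - fst p - snd p = Q - snd p - fst p" by blast
    then show ?case by (simp add: case_prod_unfold)
  qed auto
  also have "\<dots> = (\<Sum>B | B \<subseteq> ?M Q \<and> card B = b. \<Sum>A | A \<subseteq> ?m (Q - B) \<and> card A = c.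
         strict_count R (Q - B - A) \<beta>)"
    by (rule sum.Sigma[symmetric]) (auto intro!: fin)
  finally show ?case by simp
qed

lemma strict_count_converse:
  assumes "finite Q"
  shows "strict_count (R\<inverse>) Q \<beta> = strict_count R Q (rev \<beta>)"
  using assms by (induction \<beta> arbitrary: Q) (simp_all add: strict_count_snoc)

section \<open>Alternating sums over compositions\<close>

definition compositions :: "nat \<Rightarrow> nat list set" where
  "compositions n = {\<beta>. sum_list \<beta> = n \<and> 0 \<notin> set \<beta>}"

lemma compositions_0: "compositions 0 = {[]}"
proof -
  have "\<beta> = []" if "\<forall>x\<in>set \<beta>. x = 0" "0 \<notin> set \<beta>" for \<beta> :: "nat list"
    using that by (cases \<beta>) auto
  then show ?thesis by (auto simp: compositions_def)
qed

lemma finite_compositions: "finite (compositions n)"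
proof -
  have "compositions n \<subseteq> {\<beta>. set \<beta> \<subseteq> {..n} \<and> length \<beta> \<le> n}"
  proof
    fix \<beta> assume *: "\<beta> \<in> compositions n"
    have "length \<beta> \<le> sum_list \<beta>" if "0 \<notin> set \<beta>"
      using that by (induction \<beta>) auto
    then show "\<beta> \<in> {\<beta>. set \<beta> \<subseteq> {..n} \<and> length \<beta> \<le> n}"
      using * member_le_sum_list by (fastforce simp: compositions_def)
  qed
  then show ?thesis by (rule finite_subset) (simp add: finite_lists_length_le)
qed

lemma sum_compositions:
  assumes "n > 0"
  shows "(\<Sum>\<beta>\<in>compositions n. f \<beta>) = (\<Sum>b=1..n. \<Sum>\<beta>\<in>compositions (n - b). f (b # \<beta>))"
proof -
  have "(\<Sum>b=1..n. \<Sum>\<beta>\<in>compositions (n - b). f (b # \<beta>)) =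
      (\<Sum>(b, \<beta>) \<in> (SIGMA b : {1..n}. compositions (n - b)). f (b # \<beta>))"
    by (rule sum.Sigma) (simp_all add: finite_compositions)
  also have "\<dots> = (\<Sum>\<beta>\<in>compositions n. f \<beta>)"
  proof (rule sum.reindex_bij_witness[where i = "\<lambda>\<beta>. (hd \<beta>, tl \<beta>)" and j = "\<lambda>(b, \<beta>). b # \<beta>"],
      goal_cases)
    case (3 \<beta>)
    then show ?case using assms by (cases \<beta>) (auto simp: compositions_def)
  next
    case (4 \<beta>)
    then show ?case using assms by (cases \<beta>) (auto simp: compositions_def Suc_le_eq)
  qed (auto simp: compositions_def)
  finally show ?thesis by simp
qed

lemma sum_Pow_insert:
  assumes "finite S" "x \<notin> S"
  shows "(\<Sum>A\<in>Pow (insert x S). f A) = (\<Sum>A\<in>Pow S. f A + f (insert x A))"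
proof -
  have "inj_on (insert x) (Pow S)" using assms by (auto simp: inj_on_def)
  moreover have "Pow S \<inter> insert x ` Pow S = {}" using assms by auto
  ultimately show ?thesis using assms
    by (simp add: Pow_insert sum.union_disjoint sum.reindex sum.distrib)
qed

text \<open>Adding or removing a fixed element pairs off the subsets of \<open>S\<close> with opposite signs.\<close>

lemma alternating_sum_Pow:
  assumes "finite S" "S \<noteq> {}"
  shows "(\<Sum>A\<in>Pow S. (-1) ^ card A) = (0 :: int)"
proof -
  obtain x T where S: "S = insert x T" "x \<notin> T" using assms(2) by (metis Set.set_insert ex_in_conv)
  then have T: "finite T" using assms by simp
  have "(-1) ^ card A + (-1) ^ card (insert x A) = (0::int)" if "A \<in> Pow T" for A
    using that S(2) finite_subset[OF _ T, of A] by (subst card_insert_disjoint) auto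
  then show ?thesis by (simp add: S(1) sum_Pow_insert[OF T S(2)])
qed

text \<open>
  In the pair \<open>A\<close>, \<open>insert x A\<close> the weights differ by one, so one unweighted term is left, and the
  previous sum over the subsets of \<open>S - {x}\<close> remains.
\<close>

lemma alternating_card_sum_Pow:
  assumes "finite S" "S \<noteq> {}"
  shows "(\<Sum>A\<in>Pow S. (-1) ^ card A * int (card A)) = (if card S = 1 then -1 else 0 :: int)"
proof -
  obtain x T where S: "S = insert x T" "x \<notin> T" using assms(2) by (metis Set.set_insert ex_in_conv)
  then have T: "finite T" using assms by simp
  have "(-1) ^ card A * int (card A) + (-1) ^ card (insert x A) * int (card (insert x A))
      = - ((-1) ^ card A)" if "A \<in> Pow T" for A
    using that S(2) finite_subset[OF _ T, of A]
    by (subst (1 2) card_insert_disjoint) (auto simp: algebra_simps)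
  then have "(\<Sum>A\<in>Pow S. (-1) ^ card A * int (card A)) = (\<Sum>A\<in>Pow T. - ((-1) ^ card A))"
    unfolding S(1) sum_Pow_insert[OF T S(2)] by (intro sum.cong) auto
  also have "\<dots> = (if T = {} then -1 else 0)"
    using alternating_sum_Pow[OF T] by (simp add: sum_negf)
  finally show ?thesis using S T by auto
qed

text \<open>
  Summing over all compositions frees the size of the first color class: it can be any nonempty
  set of minimal elements.
\<close>

lemma sum_compositions_strict_count:
  assumes "finite Q" "Q \<noteq> {}"
  shows "(\<Sum>\<beta>\<in>compositions (card Q). f \<beta> * strict_count R Q \<beta>) =
    (\<Sum>A\<in>Pow (minimal_in R Q) - {{}}.
       \<Sum>\<beta>\<in>compositions (card (Q - A)). f (card A # \<beta>) * strict_count R (Q - A) \<beta>)"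
proof -
  let ?n = "card Q" and ?P = "Pow (minimal_in R Q) - {{}}"
  have fP: "finite ?P" using finite_minimal_in[OF assms(1)] by simp
  have sub: "A \<subseteq> Q" if "A \<in> ?P" for A using that minimal_in_subset[of R Q] by auto
  have card_sub: "card (Q - A) = ?n - card A" "card A \<in> {1..?n}" if "A \<in> ?P" for A
  proof -
    have "finite A" using sub[OF that] assms(1) finite_subset by blast
    then show "card (Q - A) = ?n - card A" using sub[OF that] by (simp add: card_Diff_subset)
    have "card A \<noteq> 0" using that \<open>finite A\<close> by auto
    then show "card A \<in> {1..?n}" using sub[OF that] assms(1) by (simp add: card_mono Suc_le_eq)
  qed
  have "?n > 0" using assms by (simp add: card_gt_0_iff)
  then have "(\<Sum>\<beta>\<in>compositions ?n. f \<beta> * strict_count R Q \<beta>) =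
      (\<Sum>b=1..?n. \<Sum>\<beta>\<in>compositions (?n - b). \<Sum>A | A \<subseteq> minimal_in R Q \<and> card A = b.
         f (b # \<beta>) * strict_count R (Q - A) \<beta>)"
    by (simp add: sum_compositions sum_distrib_left)
  also have "\<dots> = (\<Sum>b=1..?n. \<Sum>A | A \<in> ?P \<and> card A = b.
      \<Sum>\<beta>\<in>compositions (card (Q - A)). f (card A # \<beta>) * strict_count R (Q - A) \<beta>)"
  proof (rule sum.cong[OF refl])
    fix b assume b: "b \<in> {1..?n}"
    then have "{A. A \<subseteq> minimal_in R Q \<and> card A = b} = {A \<in> ?P. card A = b}" by auto
    then show "(\<Sum>\<beta>\<in>compositions (?n - b). \<Sum>A | A \<subseteq> minimal_in R Q \<and> card A = b.
         f (b # \<beta>) * strict_count R (Q - A) \<beta>) = (\<Sum>A | A \<in> ?P \<and> card A = b.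
      \<Sum>\<beta>\<in>compositions (card (Q - A)). f (card A # \<beta>) * strict_count R (Q - A) \<beta>)"
      by (subst sum.swap) (auto intro!: sum.cong simp: card_sub)
  qed
  also have "\<dots> = (\<Sum>A\<in>?P.
       \<Sum>\<beta>\<in>compositions (card (Q - A)). f (card A # \<beta>) * strict_count R (Q - A) \<beta>)"
  proof (rule sum.group[OF fP])
    show "card ` ?P \<subseteq> {1..?n}" using card_sub(2) by (intro image_subsetI)
  qed simp
  finally show ?thesis .
qed

text \<open>
  By induction every choice of the first class \<open>A\<close> contributes \<open>(-1) ^ card A\<close> up to a common sign,
  and over all nonempty \<open>A\<close> these add up to \<open>-1\<close>.
\<close>

lemma alternating_strict_count:
  assumes "finite R" "acyclic R" "finite Q"
  shows "(\<Sum>\<beta>\<in>compositions (card Q). (-1) ^ length \<beta> * strict_count R Q \<beta>) = (-1) ^ card Q"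
  using assms(3)
proof (induction "card Q" arbitrary: Q rule: less_induct)
  case less
  show ?case
  proof (cases "Q = {}")
    case True
    then show ?thesis by (simp add: compositions_0)
  next
    case False
    let ?m = "minimal_in R Q"
    have m: "finite ?m" "?m \<noteq> {}"
      using finite_minimal_in[OF less.prems] minimal_in_nonempty[OF assms(1,2) False] by auto
    have "(\<Sum>\<beta>\<in>compositions (card Q). (-1) ^ length \<beta> * strict_count R Q \<beta>) =
        (\<Sum>A\<in>Pow ?m - {{}}. - ((-1) ^ card Q * (-1) ^ card A))"
      unfolding sum_compositions_strict_count[OF less.prems False]
    proof (rule sum.cong[OF refl])
      fix A assume A: "A \<in> Pow ?m - {{}}"
      then have AQ: "A \<subseteq> Q" "A \<noteq> {}" using minimal_in_subset[of R Q] by auto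
      then have fA: "finite A" using less.prems finite_subset by blast
      have "Q - A \<subset> Q" using AQ by blast
      then have "card (Q - A) < card Q" using less.prems by (simp add: psubset_card_mono)
      moreover have c: "card Q = card (Q - A) + card A"
        using AQ fA less.prems by (metis card_Diff_subset card_mono le_add_diff_inverse2)
      ultimately show "(\<Sum>\<beta>\<in>compositions (card (Q - A)).
          (-1) ^ length (card A # \<beta>) * strict_count R (Q - A) \<beta>) =
          - ((-1) ^ card Q * (-1) ^ card A)"
        using less.hyps[of "Q - A"] less.prems
        by (simp add: sum_negf power_add flip: power_mult_distrib)
    qed
    also have "\<dots> = (-1) ^ card Q"
      using alternating_sum_Pow[OF m] m by (simp add: sum_negf sum_diff1 flip: sum_distrib_left)
    finally show ?thesis .
  qed
qed

text \<open>
  For a symmetric function, taking the coefficient of \<open>x\<^sup>\<beta>\<close> is pairing with the complete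
  homogeneous function \<open>h\<^sub>\<beta>\<close>.  Since the power sum \<open>p\<^sub>n\<close> is the sum of
  \<open>(-1)\<close> to the power \<open>length \<beta> - 1\<close> times \<open>hd \<beta>\<close> times \<open>h\<^sub>\<beta>\<close> over the compositions
  \<open>\<beta>\<close> of \<open>n\<close>, the following functional of the coefficients is pairing with \<open>- p\<^sub>n\<close>.
\<close>

abbreviation power_sum_functional :: "nat \<Rightarrow> (nat list \<Rightarrow> int) \<Rightarrow> int" where
  "power_sum_functional n f \<equiv> \<Sum>\<beta>\<in>compositions n. (-1) ^ length \<beta> * int (hd \<beta>) * f \<beta>"

text \<open>
  Once the first class \<open>A\<close> is chosen, the rest contributes only a sign, so the sum collapses to
  the sum of \<open>(-1) ^ card A * int (card A)\<close> over the sets \<open>A\<close> of minimal elements.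
\<close>

lemma power_sum_functional_strict_count:
  assumes "finite R" "acyclic R" "finite Q" "Q \<noteq> {}"
  shows "power_sum_functional (card Q) (strict_count R Q) =
    (if card (minimal_in R Q) = 1 then (-1) ^ card Q else 0)"
proof -
  let ?m = "minimal_in R Q"
  have m: "finite ?m" "?m \<noteq> {}"
    using finite_minimal_in[OF assms(3)] minimal_in_nonempty[OF assms(1,2,4)] by auto
  have "(\<Sum>\<beta>\<in>compositions (card Q). (-1) ^ length \<beta> * int (hd \<beta>) * strict_count R Q \<beta>) =
      (\<Sum>A\<in>Pow ?m - {{}}. - ((-1) ^ card Q * ((-1) ^ card A * int (card A))))"
    unfolding sum_compositions_strict_count[OF assms(3,4)]
  proof (rule sum.cong[OF refl])
    fix A assume A: "A \<in> Pow ?m - {{}}"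
    then have AQ: "A \<subseteq> Q" using minimal_in_subset[of R Q] by auto
    then have fA: "finite A" using assms finite_subset by blast
    have c: "card Q = card (Q - A) + card A"
      using AQ fA assms by (metis card_Diff_subset card_mono le_add_diff_inverse2)
    have "(\<Sum>\<beta>\<in>compositions (card (Q - A)).
        (-1) ^ length (card A # \<beta>) * int (hd (card A # \<beta>)) * strict_count R (Q - A) \<beta>) =
        - int (card A) * (\<Sum>\<beta>\<in>compositions (card (Q - A)).
        (-1) ^ length \<beta> * strict_count R (Q - A) \<beta>)"
      by (simp add: sum_distrib_left sum_negf ac_simps)
    also have "\<dots> = - int (card A) * (-1) ^ card (Q - A)"
      using alternating_strict_count[OF assms(1,2)] assms(3) by simp
    finally show "(\<Sum>\<beta>\<in>compositions (card (Q - A)).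
        (-1) ^ length (card A # \<beta>) * int (hd (card A # \<beta>)) * strict_count R (Q - A) \<beta>) =
        - ((-1) ^ card Q * ((-1) ^ card A * int (card A)))"
      using c by (simp add: power_add flip: power_mult_distrib)
  qed
  also have "\<dots> = - ((-1) ^ card Q * (\<Sum>A\<in>Pow ?m. (-1) ^ card A * int (card A)))"
    using m by (simp add: sum_negf sum_diff1 flip: sum_distrib_left)
  also have "\<dots> = (if card ?m = 1 then (-1) ^ card Q else 0)"
    unfolding alternating_card_sum_Pow[OF m] by simp
  finally show ?thesis .
qed

section \<open>The power sum functional before and after single colors\<close>

text \<open>
  A coloring with content \<open>replicate N 1 @ \<beta>\<close> peels off \<open>N\<close> single vertices from below and
  leaves a set closed under outgoing edges; that set contributes \<open>1\<close> (up to a global sign) if it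
  has exactly one minimal element and \<open>0\<close> otherwise.  So there is no cancellation, and a single
  suitable set \<open>U\<close> makes the value nonzero.
\<close>

lemma power_sum_functional_after_singletons_pos:
  assumes "finite R" "acyclic R" "finite Q" "card Q = N + M" "M > 0"
    and "U \<subseteq> Q" "card U = M" "card (minimal_in R U) = 1"
    and "\<forall>u\<in>U. \<forall>v\<in>Q. (u, v) \<in> R \<longrightarrow> v \<in> U"
  shows "0 < (-1) ^ M * power_sum_functional M (\<lambda>\<beta>. strict_count R Q (replicate N 1 @ \<beta>))"
    (is "0 < ?S N Q")
proof -
  have "0 \<le> ?S N Q \<and> (U \<subseteq> Q \<longrightarrow> card U = M \<longrightarrow> card (minimal_in R U) = 1 \<longrightarrow>
      (\<forall>u\<in>U. \<forall>v\<in>Q. (u, v) \<in> R \<longrightarrow> v \<in> U) \<longrightarrow> 0 < ?S N Q)"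
    using assms(3,4)
  proof (induction N arbitrary: Q)
    case 0
    then have "Q \<noteq> {}" using assms(5) by auto
    then have "?S 0 Q = (if card (minimal_in R Q) = 1 then 1 else 0)"
      using power_sum_functional_strict_count[OF assms(1,2) 0(1)] 0(2)
      by (simp flip: power_mult_distrib)
    moreover have "U = Q" if "U \<subseteq> Q" "card U = M"
      using that 0 by (simp add: card_subset_eq)
    ultimately show ?case by auto
  next
    case (Suc N)
    let ?I = "{A. A \<subseteq> minimal_in R Q \<and> card A = 1}"
    have fI: "finite ?I" using finite_minimal_in[OF Suc.prems(1)] by simp
    have step: "?S (Suc N) Q = (\<Sum>A\<in>?I. ?S N (Q - A))"
      by (simp add: sum_distrib_left ac_simps) (rule sum.swap)
    have cQ: "card (Q - A) = N + M" if "A \<in> ?I" for A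
    proof -
      have "finite A" using that by (auto intro: card_ge_0_finite)
      moreover have "A \<subseteq> Q" using that minimal_in_subset[of R Q] by auto
      ultimately show ?thesis using that Suc.prems by (simp add: card_Diff_subset)
    qed
    have nn: "0 \<le> ?S N (Q - A)" if "A \<in> ?I" for A
      using Suc.IH[of "Q - A"] cQ[OF that] Suc.prems by blast
    have "0 < ?S (Suc N) Q" if U: "U \<subseteq> Q" "card U = M" "card (minimal_in R U) = 1"
      "\<forall>u\<in>U. \<forall>v\<in>Q. (u, v) \<in> R \<longrightarrow> v \<in> U"
    proof -
      have "Q - U \<noteq> {}" using U(1,2) Suc.prems by (auto dest: subset_antisym)
      then obtain x where x: "x \<in> minimal_in R (Q - U)"
        using minimal_in_nonempty[OF assms(1,2), of "Q - U"] by auto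
      then have "x \<in> Q - U" "\<forall>u\<in>Q - U. (u, x) \<notin> R" unfolding minimal_in_def by simp_all
      moreover from this(1) have "\<forall>u\<in>U. (u, x) \<notin> R" using U(4) by blast
      ultimately have "x \<in> minimal_in R Q" unfolding minimal_in_def by blast
      then have xI: "{x} \<in> ?I" by simp
      moreover have "U \<subseteq> Q - {x}" using U(1) x minimal_in_subset[of R "Q - U"] by auto
      ultimately have "0 < ?S N (Q - {x})"
        using Suc.IH[of "Q - {x}"] cQ[OF xI] Suc.prems(1) U(2-4) by simp
      then show ?thesis unfolding step using fI nn xI by (intro sum_pos2) auto
    qed
    moreover have "0 \<le> ?S (Suc N) Q" unfolding step using nn by (rule sum_nonneg)
    ultimately show ?case by (intro conjI impI)
  qed
  then show ?thesis using assms(6-9) by (elim conjE) (drule mp | assumption)+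
qed

text \<open>
  The mirror image: the \<open>N\<close> single vertices are now removed from above, and what is left is
  closed under incoming edges.
\<close>

lemma power_sum_functional_before_singletons_nonzero:
  assumes "finite R" "acyclic R" "finite Q" "card Q = N + M" "M > 0"
    and "power_sum_functional M (\<lambda>\<beta>. strict_count R Q (\<beta> @ replicate N 1)) \<noteq> 0" (is "?S N Q \<noteq> 0")
  obtains D where "D \<subseteq> Q" "card D = M" "card (minimal_in R D) = 1"
    "\<forall>v\<in>D. \<forall>u\<in>Q. (u, v) \<in> R \<longrightarrow> u \<in> D"
proof -
  have "\<exists>D\<subseteq>Q. card D = M \<and> card (minimal_in R D) = 1 \<and> (\<forall>v\<in>D. \<forall>u\<in>Q. (u, v) \<in> R \<longrightarrow> u \<in> D)"
    using assms(3,4,6)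
  proof (induction N arbitrary: Q)
    case 0
    then have "Q \<noteq> {}" using assms(5) by auto
    then have "card (minimal_in R Q) = 1"
      using power_sum_functional_strict_count[OF assms(1,2) 0(1)] 0 by (auto split: if_splits)
    then show ?case using 0 by auto
  next
    case (Suc N)
    let ?I = "{A. A \<subseteq> minimal_in (R\<inverse>) Q \<and> card A = 1}"
    have "?S (Suc N) Q = power_sum_functional M (\<lambda>\<beta>. strict_count R Q ((\<beta> @ replicate N 1) @ [1]))"
      by (simp add: replicate_append_same)
    also have "\<dots> = (\<Sum>A\<in>?I. ?S N (Q - A))"
      unfolding strict_count_snoc[OF Suc.prems(1)] sum_distrib_left by (rule sum.swap)
    finally have "(\<Sum>A\<in>?I. ?S N (Q - A)) \<noteq> 0" using Suc.prems by simp
    then obtain A where A: "A \<in> ?I" "?S N (Q - A) \<noteq> 0" by (meson sum.neutral)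
    have "finite A" using A by (auto intro: card_ge_0_finite)
    moreover have AQ: "A \<subseteq> Q" using A minimal_in_subset[of "R\<inverse>" Q] by auto
    ultimately have "card (Q - A) = N + M" using A Suc.prems by (simp add: card_Diff_subset)
    then obtain D where D: "D \<subseteq> Q - A" "card D = M" "card (minimal_in R D) = 1"
      "\<forall>v\<in>D. \<forall>u\<in>Q - A. (u, v) \<in> R \<longrightarrow> u \<in> D"
      using Suc.IH[of "Q - A"] A Suc.prems by blast
    moreover have "u \<notin> A" if "v \<in> D" "(u, v) \<in> R" for u v
      using that A D(1) by (auto simp: minimal_in_def)
    ultimately have "\<forall>v\<in>D. \<forall>u\<in>Q. (u, v) \<in> R \<longrightarrow> u \<in> D" by blast
    with D show ?case by blast
  qed
  then show thesis using that by blast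
qed

section \<open>Symmetric counts force a unique minimal element\<close>

lemma unique_minimal_reaches_all:
  assumes "finite R" "acyclic R" "minimal_in R D = {b}"
  shows "D \<subseteq> R\<^sup>* `` {b}"
proof (rule ccontr)
  assume "\<not> D \<subseteq> R\<^sup>* `` {b}"
  then have "D - R\<^sup>* `` {b} \<noteq> {}" by blast
  then obtain x where x: "x \<in> minimal_in R (D - R\<^sup>* `` {b})"
    using minimal_in_nonempty[OF assms(1,2), of "D - R\<^sup>* `` {b}"] by auto
  then have xD: "x \<in> D" "(b, x) \<notin> R\<^sup>*" by (auto simp: minimal_in_def)
  then have "x \<noteq> b" by auto
  then have "x \<notin> minimal_in R D" using assms(3) by simp
  then obtain u where u: "u \<in> D" "(u, x) \<in> R" using xD by (auto simp: minimal_in_def)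
  then have "(b, u) \<in> R\<^sup>*" using x by (auto simp: minimal_in_def)
  then show False using u xD by (meson rtrancl.rtrancl_into_rtrancl)
qed

lemma minimal_in_reachable:
  assumes "acyclic R"
  shows "minimal_in R (R\<^sup>* `` {a}) = {a}"
proof
  show "minimal_in R (R\<^sup>* `` {a}) \<subseteq> {a}"
    by (auto simp: minimal_in_def elim: rtranclE)
  have "(u, a) \<notin> R" if "(a, u) \<in> R\<^sup>*" for u
    using that assms by (meson acyclic_def rtrancl_into_trancl1)
  then show "{a} \<subseteq> minimal_in R (R\<^sup>* `` {a})" by (auto simp: minimal_in_def)
qed

text \<open>
  The number \<open>M\<close> below is chosen maximal so that a set of \<open>M\<close> elements with a unique minimal
  element \<open>b\<close> cannot miss anything reachable from \<open>b\<close>.  The assumption \<open>conn\<close> expresses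
  connectedness of the underlying undirected graph, and \<open>sym\<close> comes from the symmetry of the series.
\<close>

lemma symmetric_counts_unique_minimal:
  assumes fin: "finite V" "V \<noteq> {}" and RV: "R \<subseteq> V \<times> V" and acyc: "acyclic R"
    and conn: "\<And>D. \<lbrakk>D \<subseteq> V; D \<noteq> {}; \<And>u v. (u, v) \<in> R \<Longrightarrow> u \<in> D \<longleftrightarrow> v \<in> D\<rbrakk> \<Longrightarrow> D = V"
    and sym: "\<And>\<beta> \<gamma>. mset \<beta> = mset \<gamma> \<Longrightarrow> strict_count R V \<beta> = strict_count R V \<gamma>"
  shows "card (minimal_in R V) = 1"
proof -
  have finR: "finite R" using fin RV finite_subset by blast
  let ?up = "\<lambda>a. R\<^sup>* `` {a}"
  have upV: "?up a \<subseteq> V" if "a \<in> V" for a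
  proof
    fix x assume "x \<in> ?up a"
    then have "(a, x) \<in> R\<^sup>*" by simp
    then show "x \<in> V" using that RV by (induction rule: rtrancl_induct) auto
  qed
  define M where "M = Max ((\<lambda>a. card (?up a)) ` V)"
  have "M \<in> (\<lambda>a. card (?up a)) ` V" unfolding M_def using fin by (intro Max_in) auto
  then obtain a where a: "a \<in> V" "card (?up a) = M" by auto
  have Mmax: "card (?up b) \<le> M" if "b \<in> V" for b unfolding M_def using fin that by simp
  have M0: "M > 0"
  proof -
    have "finite (?up a)" using upV[OF a(1)] fin(1) by (rule finite_subset)
    moreover have "a \<in> ?up a" by simp
    ultimately show ?thesis using a(2) card_gt_0_iff by blast
  qed
  define N where "N = card V - M"
  have "M \<le> card V" using a upV[OF a(1)] fin(1) by (metis card_mono)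
  then have cV: "card V = N + M" by (simp add: N_def)
  have "card (minimal_in R (?up a)) = 1"
    by (simp add: minimal_in_reachable[OF acyc])
  moreover have "\<forall>u\<in>?up a. \<forall>v\<in>V. (u, v) \<in> R \<longrightarrow> v \<in> ?up a"
    by (auto intro: rtrancl.rtrancl_into_rtrancl)
  ultimately have
    "0 < (-1) ^ M * power_sum_functional M (\<lambda>\<beta>. strict_count R V (replicate N 1 @ \<beta>))"
    by (rule power_sum_functional_after_singletons_pos[OF finR acyc fin(1) cV M0 upV[OF a(1)] a(2)])
  \<comment> \<open>Symmetry enters here: multiplying by \<open>p\<^sub>M\<close> before or after the single variables is the same.\<close>
  moreover have "strict_count R V (replicate N 1 @ \<beta>) = strict_count R V (\<beta> @ replicate N 1)" for \<beta>
    by (rule sym) simp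
  ultimately have "power_sum_functional M (\<lambda>\<beta>. strict_count R V (\<beta> @ replicate N 1)) \<noteq> 0"
    by (simp only:) auto
  then obtain D where D: "D \<subseteq> V" "card D = M" "card (minimal_in R D) = 1"
    "\<forall>v\<in>D. \<forall>u\<in>V. (u, v) \<in> R \<longrightarrow> u \<in> D"
    using power_sum_functional_before_singletons_nonzero[OF finR acyc fin(1) cV M0] by blast
  obtain b where b: "minimal_in R D = {b}" using D(3) by (auto simp: card_1_singleton_iff)
  then have bV: "b \<in> V" using D(1) minimal_in_subset[of R D] by auto
  \<comment> \<open>\<open>D\<close> lies in the reachable set of \<open>b\<close>, which by the choice of \<open>M\<close> is not larger.\<close>
  have "D = ?up b"
  proof (rule card_seteq)
    show "finite (?up b)" using upV[OF bV] fin(1) by (rule finite_subset)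
    show "D \<subseteq> ?up b" by (rule unique_minimal_reaches_all[OF finR acyc b])
    show "card (?up b) \<le> card D" using Mmax[OF bV] D(2) by simp
  qed
  have "D = V"
  proof (rule conn)
    fix u v assume uv: "(u, v) \<in> R"
    show "u \<in> D \<longleftrightarrow> v \<in> D"
    proof
      assume "u \<in> D"
      then show "v \<in> D" unfolding \<open>D = ?up b\<close> using uv by (auto intro: rtrancl.rtrancl_into_rtrancl)
    next
      assume "v \<in> D"
      moreover have "u \<in> V" using uv RV by blast
      ultimately show "u \<in> D" using D(4) uv by blast
    qed
  qed (use D(1,2) M0 in auto)
  then show ?thesis using D(3) by simp
qed

section \<open>The leading coefficient of the chromatic quasisymmetric function\<close>

text \<open>
  All edges are ascents exactly when the coloring increases along edges, and such a coloring is
  automatically proper.  The leading \<open>0\<close> in the exponent vector accounts for the variable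
  \<open>x\<^sub>0\<close>, which is not a color.
\<close>

lemma leading_coeff_chromatic_quasisymmetric:
  assumes "digraph G"
  shows "poly.coeff (chromatic_quasisymmetric G (Poly_Mapping.nth (0 # \<beta>))) (card (arcs G)) =
    strict_count (arcs_ends G) (verts G) \<beta>"
proof -
  interpret digraph G by fact
  let ?m = "Poly_Mapping.nth (0 # \<beta>)"
  let ?C = "{\<kappa>. \<kappa> \<in> proper_colorings G \<and> coloring_monomial G \<kappa> = ?m}"
  have fC: "finite ?C" using finite_colorings_of_monomial[of G ?m] by simp
  have mono: "coloring_monomial G \<kappa> = ?m \<longleftrightarrow>
      (\<forall>i. card {v \<in> verts G. \<kappa> v = i} = nth_default 0 (replicate 1 0 @ \<beta>) i)" for \<kappa>
    by (simp add: poly_mapping_eq_iff fun_eq_iff lookup_coloring_monomial nth.rep_eq)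
  have top: "asc G \<kappa> = card (arcs G) \<longleftrightarrow> (\<forall>e\<in>arcs G. \<kappa> (tail G e) < \<kappa> (head G e))"
    for \<kappa> :: "'a \<Rightarrow> nat"
  proof
    assume "asc G \<kappa> = card (arcs G)"
    then have "{e \<in> arcs G. \<kappa> (tail G e) < \<kappa> (head G e)} = arcs G"
      unfolding asc_def by (intro card_subset_eq) auto
    then show "\<forall>e\<in>arcs G. \<kappa> (tail G e) < \<kappa> (head G e)" by blast
  next
    assume "\<forall>e\<in>arcs G. \<kappa> (tail G e) < \<kappa> (head G e)"
    then have "{e \<in> arcs G. \<kappa> (tail G e) < \<kappa> (head G e)} = arcs G" by blast
    then show "asc G \<kappa> = card (arcs G)" by (simp add: asc_def)
  qed
  have "{\<kappa> \<in> ?C. asc G \<kappa> = card (arcs G)} =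
      strict_colorings (arcs_ends G) (verts G) (replicate 1 0 @ \<beta>)" (is "?L = ?R")
  proof (intro equalityI subsetI)
    fix \<kappa> assume "\<kappa> \<in> ?L"
    then show "\<kappa> \<in> ?R"
      unfolding strict_colorings_def mem_Collect_eq mono top
      by (auto simp: proper_colorings_def arcs_ends_def arc_to_ends_def PiE_def)
  next
    fix \<kappa> assume \<kappa>: "\<kappa> \<in> ?R"
    have lt: "\<kappa> (tail G e) < \<kappa> (head G e)" if "e \<in> arcs G" for e
      using \<kappa> that by (auto simp: strict_colorings_def arcs_ends_def arc_to_ends_def)
    have "\<kappa> v \<noteq> 0" if "v \<in> verts G" for v
    proof
      assume "\<kappa> v = 0"
      moreover have "card {w \<in> verts G. \<kappa> w = 0} = 0"
        using \<kappa> by (simp add: strict_colorings_def)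
      ultimately show False using that by auto
    qed
    then show "\<kappa> \<in> ?L"
      using \<kappa> lt unfolding strict_colorings_def mem_Collect_eq mono top
      by (auto simp: proper_colorings_def PiE_def Suc_le_eq dest: lt)
  qed
  then have "int (card {\<kappa> \<in> ?C. asc G \<kappa> = card (arcs G)}) =
      strict_count (arcs_ends G) (verts G) \<beta>"
    using card_strict_colorings[of "verts G" "arcs_ends G" 1 \<beta>] by simp
  moreover have "poly.coeff (chromatic_quasisymmetric G ?m) (card (arcs G)) =
      (\<Sum>\<kappa>\<in>?C. if asc G \<kappa> = card (arcs G) then 1 else 0)"
    by (simp add: chromatic_quasisymmetric_def coeff_sum)
  ultimately show ?thesis using fC by (simp flip: sum.inter_filter)
qed

lemma symmetric_series_nth_mset:
  assumes "symmetric_series F" "mset \<beta> = mset \<gamma>"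
  shows "F (Poly_Mapping.nth (0 # \<beta>)) = F (Poly_Mapping.nth (0 # \<gamma>))"
proof -
  obtain p where p: "p permutes {..<length \<gamma>}" "permute_list p \<gamma> = \<beta>"
    using mset_eq_permutation[OF assms(2)] by blast
  \<comment> \<open>List position \<open>i\<close> belongs to the variable with index \<open>Suc i\<close>.\<close>
  define \<pi> where "\<pi> j = (case j of 0 \<Rightarrow> 0 | Suc i \<Rightarrow> Suc (p i))" for j
  have len: "length \<beta> = length \<gamma>" using assms(2) by (metis size_mset)
  have "bij p" using p(1) permutes_bij by blast
  then have inj: "inj p" and surj: "surj p" by (auto simp: bij_def)
  have "bij \<pi>"
  proof (rule bijI)
    show "inj \<pi>"
    proof (rule injI)
      fix x y assume "\<pi> x = \<pi> y"
      then show "x = y" using inj by (cases x; cases y) (simp_all add: \<pi>_def inj_eq)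
    qed
    have "\<exists>x. y = \<pi> x" for y
    proof (cases y)
      case (Suc i)
      obtain j where "i = p j" using surj by (meson surjD)
      then have "y = \<pi> (Suc j)" using Suc by (simp add: \<pi>_def)
      then show ?thesis by blast
    qed (auto simp: \<pi>_def intro: exI[of _ 0])
    then show "surj \<pi>" by (auto simp: surj_def)
  qed
  moreover have "\<pi> x = x" if "x \<notin> {1..}" for x using that by (simp add: \<pi>_def not_le)
  ultimately have perm: "\<pi> permutes {1..}" by (simp add: permutes_def bij_iff)
  have "Poly_Mapping.lookup (Poly_Mapping.map_key \<pi> (Poly_Mapping.nth (0 # \<gamma>))) j =
      Poly_Mapping.lookup (Poly_Mapping.nth (0 # \<beta>)) j" for j
  proof -
    have "nth_default 0 (0 # \<gamma>) (\<pi> j) = nth_default 0 (0 # \<beta>) j"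
    proof (cases j)
      case (Suc i)
      have "p i < length \<gamma> \<longleftrightarrow> i < length \<gamma>" using permutes_in_image[OF p(1), of i] by simp
      then show ?thesis
        using Suc p len permute_list_nth[of p \<gamma> i] by (auto simp: \<pi>_def nth_default_def)
    qed (simp add: \<pi>_def)
    then show ?thesis using \<open>bij \<pi>\<close> by (simp add: map_key.rep_eq bij_def nth.rep_eq)
  qed
  then have "Poly_Mapping.map_key \<pi> (Poly_Mapping.nth (0 # \<gamma>)) = Poly_Mapping.nth (0 # \<beta>)"
    by (intro poly_mapping_eqI)
  then show ?thesis
    using assms(1) perm unfolding symmetric_series_def permute_vars_def by metis
qed

lemma connected_closed_eq_verts:
  assumes "connected G" "D \<subseteq> verts G" "D \<noteq> {}"
    and closed: "\<And>u v. (u, v) \<in> arcs_ends G \<Longrightarrow> u \<in> D \<longleftrightarrow> v \<in> D"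
  shows "D = verts G"
proof
  show "verts G \<subseteq> D"
  proof
    fix w assume w: "w \<in> verts G"
    obtain d where d: "d \<in> D" using assms by blast
    have "d \<rightarrow>\<^sup>*\<^bsub>with_proj (mk_symmetric G)\<^esub> w"
      using assms(1,2) d w unfolding connected_def strongly_connected_def by auto
    then have "(d, w) \<in> (parcs (mk_symmetric G))\<^sup>*"
      by (auto simp: reachable_def dest: rtrancl_on_rtranclI)
    then show "w \<in> D"
    proof (induction rule: rtrancl_induct)
      case (step y z)
      then have "(y, z) \<in> arcs_ends G \<or> (z, y) \<in> arcs_ends G"
        by (auto simp: parcs_mk_symmetric arcs_ends_conv)
      then show ?case using closed step.IH by blast
    qed (rule d)
  qed
qed (use assms in auto)

theorem theorem1p6:
  fixes G :: "('a, 'b) pre_digraph"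
  assumes "digraph G"
    and "acyclic (arcs_ends G)"
    and "connected G"
    and "card (sinks G) > 1 \<or> card (sources G) > 1"
  shows "\<not> symmetric_series (chromatic_quasisymmetric G)"
proof
  assume sym: "symmetric_series (chromatic_quasisymmetric G)"
  interpret digraph G by fact
  let ?R = "arcs_ends G" and ?V = "verts G"
  have eq: "strict_count ?R ?V \<beta> = strict_count ?R ?V \<gamma>" if "mset \<beta> = mset \<gamma>" for \<beta> \<gamma>
    unfolding leading_coeff_chromatic_quasisymmetric[OF assms(1), symmetric]
    using symmetric_series_nth_mset[OF sym that] by simp
  have V: "?V \<noteq> {}" using assms(3) unfolding connected_def strongly_connected_def by auto
  have RV: "?R \<subseteq> ?V \<times> ?V" by (auto simp: arcs_ends_def arc_to_ends_def)
  have "card (minimal_in ?R ?V) = 1"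
  proof (rule symmetric_counts_unique_minimal)
    show "D = ?V" if "D \<subseteq> ?V" "D \<noteq> {}" "\<And>u v. (u, v) \<in> ?R \<Longrightarrow> u \<in> D \<longleftrightarrow> v \<in> D" for D
      by (rule connected_closed_eq_verts[OF assms(3) that])
  qed (fact finite_verts V RV assms(2) eq)+
  moreover have "card (minimal_in (?R\<inverse>) ?V) = 1"
  proof (rule symmetric_counts_unique_minimal)
    show "strict_count (?R\<inverse>) ?V \<beta> = strict_count (?R\<inverse>) ?V \<gamma>" if "mset \<beta> = mset \<gamma>" for \<beta> \<gamma>
      unfolding strict_count_converse[OF finite_verts] using that by (intro eq) simp
    show "D = ?V" if "D \<subseteq> ?V" "D \<noteq> {}" "\<And>u v. (u, v) \<in> ?R\<inverse> \<Longrightarrow> u \<in> D \<longleftrightarrow> v \<in> D" for D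
      by (rule connected_closed_eq_verts[OF assms(3) that(1,2)]) (use that(3) in blast)
    show "?R\<inverse> \<subseteq> ?V \<times> ?V" using RV by blast
    show "acyclic (?R\<inverse>)" using assms(2) by simp
  qed (rule finite_verts, rule V)
  moreover have "sources G = minimal_in ?R ?V"
    by (fastforce simp: sources_def minimal_in_def arcs_ends_def arc_to_ends_def in_arcs_def)
  moreover have "sinks G = minimal_in (?R\<inverse>) ?V"
    by (fastforce simp: sinks_def minimal_in_def arcs_ends_def arc_to_ends_def out_arcs_def)
  ultimately show False using assms(4) by simp
qed

end
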